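(* Let $\mathcal{X}$ be a finite set, let $\pi$ be a probability measure on $\mathcal{X}$ with strictly positive masses, and let $P\in\mathcal{L}(\pi)$. For every $S\subset\mathcal{X}$ with $S\ne\emptyset,\mathcal{X}$ and complement $S'$, $$H_\pi(PG_S)=H(\pi)-D_{\mathrm{KL}}^\pi(PG_S\,\|\,\Pi)=H(\pi)+U(S)-T(S),$$ which is a difference of two supermodular (or equivalently submodular) functions of $S$, where, with $\phi(t)=t\log t$ and $\phi(0)=0$, $$T(S)=\sum_{x\in\mathcal{X}}\pi(x)\big[\phi(P(x,S))+\phi(P(x,S'))\big],\qquad U(S)=\phi(\pi(S))+\phi(\pi(S')).$$ In particular, $$\operatorname*{arg\,min}_{S\ne\emptyset,\mathcal{X}}D_{\mathrm{KL}}^\pi(PG_S\,\|\,\Pi)=\operatorname*{arg\,max}_{S\ne\emptyset,\mathcal{X}}H_\pi(PG_S).$$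
   Context: $\mathcal{L}(\pi)$ is the set of $\pi$-reversible transition matrices on $\mathcal{X}$. $P(x,S)=\sum_{y\in S}P(x,y)$ and $\pi(S)=\sum_{y\in S}\pi(y)$. $G_S$ is the Gibbs kernel of the partition $\mathcal{X}=S\sqcup S'$: $G_S(x,y)=\pi(y)/\pi(S)$ if $x,y\in S$, $\pi(y)/\pi(S')$ if $x,y\in S'$, and $0$ otherwise. $\Pi$ is the matrix all of whose rows equal $\pi$. $D^\pi_{\mathrm{KL}}(A\|B)=\sum_{x,y}\pi(x)A(x,y)\log\frac{A(x,y)}{B(x,y)}$, with $0\log(0/a)=0$. $H(\pi)=-\sum_x\pi(x)\log\pi(x)$ is the Shannon entropy, and $H_\pi(Q)=-\sum_{x,y}\pi(x)Q(x,y)\log Q(x,y)$ is the entropy rate of a $\pi$-stationary transition matrix $Q$ (with $0\log0=0$). A set function $F:2^{\mathcal{X}}\to\mathbb{R}$ is submodular if $F(A\cap B)+F(A\cup B)\le F(A)+F(B)$ for all $A,B\subseteq\mathcal{X}$, and supermodular if $-F$ is submodular. *)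

theory Defs
  imports "HOL-Analysis.Analysis" "HOL-Probability.Probability_Mass_Function"
begin

text \<open>
  The finite state space is a type of class \<open>finite\<close>, a probability measure on it is a \<open>pmf\<close>,
  and a matrix \<open>P\<close> is read as \<open>P(x, y) = P $ x $ y\<close>, so that the composition of kernels is the
  matrix product \<open>**\<close>. Logarithms are natural. Since \<open>0 * ln 0 = 0 * ln (0 / a) = 0\<close> holds
  in HOL, the conventions for \<open>0 log 0\<close> need no case distinctions.
\<close>

definition transition_matrix :: "real ^ 'a ^ 'a :: finite \<Rightarrow> bool" where
  "transition_matrix P \<longleftrightarrow>
     (\<forall>x y. 0 \<le> P $ x $ y) \<and> (\<forall>x. (\<Sum>y\<in>UNIV. P $ x $ y) = 1)"

definition reversible_matrices :: "'a pmf \<Rightarrow> (real ^ 'a ^ 'a :: finite) set" where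
  "reversible_matrices \<pi> =
     {P. transition_matrix P \<and> (\<forall>x y. pmf \<pi> x * P $ x $ y = pmf \<pi> y * P $ y $ x)}"

definition trans_prob :: "real ^ 'a ^ 'a :: finite \<Rightarrow> 'a \<Rightarrow> 'a set \<Rightarrow> real" where
  "trans_prob P x S = (\<Sum>y\<in>S. P $ x $ y)"

definition gibbs_kernel :: "'a pmf \<Rightarrow> 'a set \<Rightarrow> real ^ 'a ^ 'a :: finite" where
  "gibbs_kernel \<pi> S = (\<chi> x y.
     if x \<in> S \<and> y \<in> S then pmf \<pi> y / measure_pmf.prob \<pi> S
     else if x \<in> - S \<and> y \<in> - S then pmf \<pi> y / measure_pmf.prob \<pi> (- S)
     else 0)"

definition stationary_matrix :: "'a pmf \<Rightarrow> real ^ 'a ^ 'a :: finite" where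
  "stationary_matrix \<pi> = (\<chi> x y. pmf \<pi> y)"

text \<open>
  The real-valued divergence below is the usual one only if \<open>B $ x $ y = 0\<close> implies
  \<open>A $ x $ y = 0\<close> on the support of \<open>\<pi>\<close> (otherwise it should be infinite); this is automatic
  when \<open>B\<close> is \<open>stationary_matrix \<pi>\<close> for a strictly positive \<open>\<pi>\<close>.
\<close>

definition KL_div :: "'a pmf \<Rightarrow> real ^ 'a ^ 'a :: finite \<Rightarrow> real ^ 'a ^ 'a \<Rightarrow> real" where
  "KL_div \<pi> A B =
     (\<Sum>x\<in>UNIV. \<Sum>y\<in>UNIV. pmf \<pi> x * A $ x $ y * ln (A $ x $ y / B $ x $ y))"

definition shannon_entropy :: "'a :: finite pmf \<Rightarrow> real" where
  "shannon_entropy \<pi> = - (\<Sum>x\<in>UNIV. pmf \<pi> x * ln (pmf \<pi> x))"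

definition entropy_rate :: "'a pmf \<Rightarrow> real ^ 'a ^ 'a :: finite \<Rightarrow> real" where
  "entropy_rate \<pi> Q =
     - (\<Sum>x\<in>UNIV. \<Sum>y\<in>UNIV. pmf \<pi> x * Q $ x $ y * ln (Q $ x $ y))"

definition submodular :: "('a set \<Rightarrow> real) \<Rightarrow> bool" where
  "submodular F \<longleftrightarrow> (\<forall>A B. F (A \<inter> B) + F (A \<union> B) \<le> F A + F B)"

definition supermodular :: "('a set \<Rightarrow> real) \<Rightarrow> bool" where
  "supermodular F \<longleftrightarrow> submodular (\<lambda>S. - F S)"

definition xlogx :: "real \<Rightarrow> real" where
  "xlogx t = t * ln t"

definition T_fun :: "'a pmf \<Rightarrow> real ^ 'a ^ 'a :: finite \<Rightarrow> 'a set \<Rightarrow> real" where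
  "T_fun \<pi> P S =
     (\<Sum>x\<in>UNIV. pmf \<pi> x * (xlogx (trans_prob P x S) + xlogx (trans_prob P x (- S))))"

definition U_fun :: "'a pmf \<Rightarrow> 'a :: finite set \<Rightarrow> real" where
  "U_fun \<pi> S = xlogx (measure_pmf.prob \<pi> S) + xlogx (measure_pmf.prob \<pi> (- S))"

end

theory Submission
  imports Defs
begin

text \<open>
  Writing \<open>S\<^sub>y\<close> for the block of \<open>{S, -S}\<close> containing \<open>y\<close>, the kernel \<open>P G\<^sub>S\<close> has density
  \<open>P(x, S\<^sub>y) / \<pi>(S\<^sub>y)\<close> with respect to \<open>\<pi>\<close>. Stationarity of \<open>\<pi>\<close> under this kernel gives the
  first entropy identity; summing the density over the blocks and using
  \<open>\<Sum>x. \<pi>(x) P(x, S) = \<pi>(S)\<close> gives \<open>D\<^sub>K\<^sub>L = T - U\<close>. Supermodularity of \<open>T\<close> and \<open>U\<close> follows since a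
  convex function of a nonnegative additive set function is supermodular.
\<close>

subsection \<open>Convex functions of measures are supermodular\<close>

text \<open>The graph lies above each of its tangents at a positive point, and this covers the
  endpoint 0, where \<open>xlogx\<close> has no finite derivative. Averaging the tangent at the mean
  \<open>m\<close> gives convexity.\<close>

lemma convex_on_xlogx: "convex_on {0..} xlogx"
proof (rule convex_onI)
  \<comment> \<open>For \<open>t > 0\<close> this is \<open>ln (s / t) \<le> s / t - 1\<close>
    multiplied by \<open>t\<close>; for \<open>t = 0\<close> it reads
    \<open>- s \<le> 0\<close>.\<close>
  have tangent: "xlogx s + (ln s + 1) * (t - s) \<le> xlogx t" if "0 < s" "0 \<le> t" for s t
  proof (cases "t = 0")
    case False
    with that have "ln s - ln t \<le> s / t - 1"
      using ln_le_minus_one[of "s / t"] by (simp add: ln_div)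
    then have "t * (ln s - ln t) \<le> t * (s / t - 1)"
      using that by (intro mult_left_mono) auto
    with False show ?thesis by (simp add: xlogx_def algebra_simps)
  qed (use that in \<open>simp add: xlogx_def algebra_simps\<close>)
  fix t x y :: real
  assume t: "0 < t" "t < 1" and xy: "x \<in> {0..}" "y \<in> {0..}"
  define m where "m = (1 - t) * x + t * y"
  have "xlogx m \<le> (1 - t) * xlogx x + t * xlogx y"
  \<comment> \<open>There is no tangent at 0, but \<open>m = 0\<close> forces
    \<open>x = y = 0\<close>, where both sides vanish.\<close>
  proof (cases "m = 0")
    case True
    then have "(1 - t) * x = 0" "t * y = 0"
      using t xy unfolding m_def by (simp_all add: add_nonneg_eq_0_iff)
    with t True show ?thesis by (simp add: xlogx_def)
  next
    case False
    then have "0 < m" using t xy unfolding m_def by (simp add: order.strict_iff_order)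
    have "(1 - t) * (xlogx m + (ln m + 1) * (x - m)) + t * (xlogx m + (ln m + 1) * (y - m))
        \<le> (1 - t) * xlogx x + t * xlogx y"
      using t xy \<open>0 < m\<close> by (intro add_mono mult_left_mono tangent) auto
    \<comment> \<open>The last factor is 0 by the choice of \<open>m\<close>, so only
      \<open>xlogx m\<close> survives.\<close>
    also have "(1 - t) * (xlogx m + (ln m + 1) * (x - m)) + t * (xlogx m + (ln m + 1) * (y - m))
        = xlogx m + (ln m + 1) * ((1 - t) * x + t * y - m)"
      by (simp add: algebra_simps)
    finally show ?thesis by (simp add: m_def)
  qed
  then show "xlogx ((1 - t) *\<^sub>R x + t *\<^sub>R y) \<le> (1 - t) * xlogx x + t * xlogx y"
    by (simp add: m_def)
qed simp

text \<open>The points \<open>a\<close> and \<open>b\<close> lie in the interval from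
  \<open>c\<close> to \<open>d\<close> with mirrored weights, so in the sum of the two convexity
  bounds \<open>f c\<close> and \<open>f d\<close> each get total weight 1.\<close>

lemma convex_on_spread:
  fixes f :: "real \<Rightarrow> real"
  assumes f: "convex_on I f" and I: "c \<in> I" "d \<in> I"
    and le: "c \<le> a" "c \<le> b" and eq: "c + d = a + b"
  shows "f a + f b \<le> f c + f d"
proof (cases "c = d")
  case True
  with le eq have "a = c" "b = d" by linarith+
  then show ?thesis by simp
next
  case False
  with le eq have "c < d" by linarith
  \<comment> \<open>The relative position of \<open>a\<close> between \<open>c\<close> and
    \<open>d\<close>; equality of the sums puts \<open>b\<close> at position
    \<open>1 - u\<close>.\<close>
  define u where "u = (a - c) / (d - c)"
  have u: "0 \<le> u" "u \<le> 1" and ud: "u * (d - c) = a - c"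
    using le eq \<open>c < d\<close> by (simp_all add: u_def)
  have a: "a = (1 - u) *\<^sub>R c + u *\<^sub>R d" and b: "b = (1 - (1 - u)) *\<^sub>R c + (1 - u) *\<^sub>R d"
    using ud eq by (simp_all add: algebra_simps)
  have "f a \<le> (1 - u) * f c + u * f d"
    unfolding a by (rule convex_onD[OF f]) (use u I in auto)
  moreover have "f b \<le> (1 - (1 - u)) * f c + (1 - u) * f d"
    unfolding b by (rule convex_onD[OF f]) (use u I in auto)
  ultimately show ?thesis by (simp add: algebra_simps)
qed

lemma supermodular_iff: "supermodular F \<longleftrightarrow> (\<forall>A B. F A + F B \<le> F (A \<inter> B) + F (A \<union> B))"
  unfolding supermodular_def submodular_def
  by (intro all_cong1) linarith

text \<open>Additivity gives the pairs \<open>A \<inter> B\<close>, \<open>A \<union> B\<close> and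
  \<open>A\<close>, \<open>B\<close> the same total weight, and monotonicity makes the first pair
  the more spread out.\<close>

lemma supermodular_convex_sum:
  fixes f :: "real \<Rightarrow> real" and w :: "'a :: finite \<Rightarrow> real"
  assumes "convex_on {0..} f" "\<And>x. 0 \<le> w x"
  shows "supermodular (\<lambda>S. f (sum w S))"
  unfolding supermodular_iff
proof (intro allI)
  fix A B :: "'a set"
  show "f (sum w A) + f (sum w B) \<le> f (sum w (A \<inter> B)) + f (sum w (A \<union> B))"
  proof (rule convex_on_spread[OF assms(1)])
    show "sum w (A \<inter> B) + sum w (A \<union> B) = sum w A + sum w B"
      using sum.union_inter[of A B w] by simp
  qed (auto intro!: sum_nonneg sum_mono2 assms(2))
qed

text \<open>Complementation exchanges intersection and union, which enter the inequality
  symmetrically.\<close>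

lemma supermodular_Compl:
  assumes "supermodular F"
  shows "supermodular (\<lambda>S. F (- S))"
  using assms unfolding supermodular_iff by (simp add: add.commute)

lemma supermodular_add:
  assumes "supermodular F" "supermodular G"
  shows "supermodular (\<lambda>S. F S + G S)"
  using assms unfolding supermodular_iff by (smt (verit))

lemma supermodular_const: "supermodular (\<lambda>S. c)"
  by (simp add: supermodular_iff)

lemma supermodular_mult_left:
  assumes "supermodular F" "0 \<le> c"
  shows "supermodular (\<lambda>S. c * F S)"
  using assms unfolding supermodular_iff by (simp add: mult_left_mono flip: distrib_left)

lemma supermodular_sum:
  assumes "\<And>i. i \<in> I \<Longrightarrow> supermodular (F i)"
  shows "supermodular (\<lambda>S. \<Sum>i\<in>I. F i S)"
  using assms unfolding supermodular_iff by (auto simp flip: sum.distrib intro!: sum_mono)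

lemma prob_eq_sum_pmf: "measure_pmf.prob \<pi> S = sum (pmf \<pi>) S" for S :: "'a :: finite set"
  by (rule measure_measure_pmf_finite) simp

lemma supermodular_U_fun: "supermodular (U_fun \<pi>)"
  unfolding U_fun_def prob_eq_sum_pmf
  by (intro supermodular_add supermodular_convex_sum convex_on_xlogx pmf_nonneg
      supermodular_Compl[where F = "\<lambda>S. xlogx (sum (pmf \<pi>) S)"])

lemma supermodular_T_fun:
  assumes "transition_matrix P"
  shows "supermodular (T_fun \<pi> P)"
  unfolding T_fun_def trans_prob_def
  by (intro supermodular_sum supermodular_mult_left supermodular_add supermodular_convex_sum
      convex_on_xlogx pmf_nonneg
      supermodular_Compl[where F = "\<lambda>S. xlogx (sum (\<lambda>y. P $ x $ y) S)" for x])
    (use assms in \<open>auto simp: transition_matrix_def\<close>)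

subsection \<open>The entropy identities\<close>

lemma trans_prob_nonneg:
  assumes "transition_matrix P"
  shows "0 \<le> trans_prob P x S"
  using assms by (auto simp: trans_prob_def transition_matrix_def intro: sum_nonneg)

text \<open>Stationarity of \<open>\<pi>\<close> under \<open>P\<close>: detailed balance turns the
  column sums into row sums, which are 1.\<close>

lemma reversible_sum_trans_prob:
  assumes "P \<in> reversible_matrices \<pi>"
  shows "(\<Sum>x\<in>UNIV. pmf \<pi> x * trans_prob P x S) = measure_pmf.prob \<pi> S"
proof -
  have "(\<Sum>x\<in>UNIV. pmf \<pi> x * trans_prob P x S) = (\<Sum>x\<in>UNIV. \<Sum>y\<in>S. pmf \<pi> y * P $ y $ x)"
    using assms by (simp add: trans_prob_def sum_distrib_left reversible_matrices_def)
  also have "\<dots> = (\<Sum>y\<in>S. pmf \<pi> y * (\<Sum>x\<in>UNIV. P $ y $ x))"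
    by (subst sum.swap) (simp add: sum_distrib_left)
  also have "\<dots> = measure_pmf.prob \<pi> S"
    using assms by (simp add: reversible_matrices_def transition_matrix_def prob_eq_sum_pmf)
  finally show ?thesis .
qed

text \<open>Only intermediate states \<open>z\<close> in the block of \<open>y\<close> contribute,
  and on them the Gibbs kernel does not depend on \<open>z\<close>.\<close>

lemma gibbs_product_component:
  "(P ** gibbs_kernel \<pi> S) $ x $ y =
     pmf \<pi> y * (if y \<in> S then trans_prob P x S / measure_pmf.prob \<pi> S
                else trans_prob P x (- S) / measure_pmf.prob \<pi> (- S))"
proof -
  have *: "(P ** gibbs_kernel \<pi> S) $ x $ y
      = (\<Sum>z\<in>UNIV. P $ x $ z * gibbs_kernel \<pi> S $ z $ y)"
    by (simp add: matrix_matrix_mult_def)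
  have restrict: "(\<Sum>z\<in>UNIV. if z \<in> A then P $ x $ z * c else 0) = trans_prob P x A * c" for A c
    by (simp add: trans_prob_def sum_distrib_right flip: sum.inter_restrict)
  show ?thesis
  proof (cases "y \<in> S")
    case True
    then have "(P ** gibbs_kernel \<pi> S) $ x $ y
        = (\<Sum>z\<in>UNIV. if z \<in> S then P $ x $ z * (pmf \<pi> y / measure_pmf.prob \<pi> S) else 0)"
      unfolding * by (intro sum.cong) (auto simp: gibbs_kernel_def)
    with True show ?thesis by (simp only: restrict) simp
  next
    case False
    then have "(P ** gibbs_kernel \<pi> S) $ x $ y
        = (\<Sum>z\<in>UNIV. if z \<in> - S then P $ x $ z * (pmf \<pi> y / measure_pmf.prob \<pi> (- S)) else 0)"
      unfolding * by (intro sum.cong) (auto simp: gibbs_kernel_def)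
    with False show ?thesis by (simp only: restrict) simp
  qed
qed

lemma prob_pos:
  fixes \<pi> :: "'a :: finite pmf"
  assumes "\<forall>x. pmf \<pi> x > 0" "S \<noteq> {}"
  shows "0 < measure_pmf.prob \<pi> S"
  unfolding prob_eq_sum_pmf using assms by (intro sum_pos) auto

lemma gibbs_product_stationary:
  fixes \<pi> :: "'a :: finite pmf"
  assumes "\<forall>x. pmf \<pi> x > 0" "P \<in> reversible_matrices \<pi>"
  shows "(\<Sum>x\<in>UNIV. pmf \<pi> x * (P ** gibbs_kernel \<pi> S) $ x $ y) = pmf \<pi> y"
proof -
  \<comment> \<open>The block of \<open>y\<close>. It contains \<open>y\<close>, so its mass is
    positive and can be cancelled.\<close>
  define B where "B = (if y \<in> S then S else - S)"
  have "y \<in> B" by (simp add: B_def)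
  then have "0 < measure_pmf.prob \<pi> B" using assms(1) by (intro prob_pos) auto
  moreover have "(\<Sum>x\<in>UNIV. pmf \<pi> x * (P ** gibbs_kernel \<pi> S) $ x $ y)
      = (\<Sum>x\<in>UNIV. pmf \<pi> x * trans_prob P x B) * (pmf \<pi> y / measure_pmf.prob \<pi> B)"
    unfolding sum_distrib_right by (intro sum.cong) (auto simp: gibbs_product_component B_def)
  ultimately show ?thesis by (simp add: reversible_sum_trans_prob[OF assms(2)])
qed

text \<open>After splitting the logarithm of the quotient, the cross term involves \<open>x\<close>
  only through the average of column \<open>y\<close>, which stationarity replaces by the mass of
  \<open>y\<close>.\<close>

lemma entropy_rate_eq_KL_div_stationary:
  fixes \<pi> :: "'a :: finite pmf"
  assumes pos: "\<forall>x. pmf \<pi> x > 0"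
    and nonneg: "\<And>x y. 0 \<le> Q $ x $ y"
    and stationary: "\<And>y. (\<Sum>x\<in>UNIV. pmf \<pi> x * Q $ x $ y) = pmf \<pi> y"
  shows "entropy_rate \<pi> Q = shannon_entropy \<pi> - KL_div \<pi> Q (stationary_matrix \<pi>)"
proof -
  have log_quot: "q * ln (q / p) = q * ln q - q * ln p" if "0 \<le> q" "0 < p" for q p :: real
    using that by (cases "q = 0") (simp_all add: ln_div algebra_simps)
  have "KL_div \<pi> Q (stationary_matrix \<pi>)
      = (\<Sum>x\<in>UNIV. \<Sum>y\<in>UNIV. pmf \<pi> x * Q $ x $ y * ln (Q $ x $ y)
          - pmf \<pi> x * Q $ x $ y * ln (pmf \<pi> y))"
    by (simp add: KL_div_def stationary_matrix_def mult.assoc log_quot pos nonneg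
        right_diff_distrib)
  also have "\<dots> = - entropy_rate \<pi> Q
      - (\<Sum>x\<in>UNIV. \<Sum>y\<in>UNIV. pmf \<pi> x * Q $ x $ y * ln (pmf \<pi> y))"
    by (simp add: entropy_rate_def sum_subtractf)
  also have "(\<Sum>x\<in>UNIV. \<Sum>y\<in>UNIV. pmf \<pi> x * Q $ x $ y * ln (pmf \<pi> y))
      = (\<Sum>y\<in>UNIV. (\<Sum>x\<in>UNIV. pmf \<pi> x * Q $ x $ y) * ln (pmf \<pi> y))"
    by (subst sum.swap) (simp add: sum_distrib_right)
  also have "\<dots> = - shannon_entropy \<pi>"
    by (simp add: stationary shannon_entropy_def)
  finally show ?thesis by simp
qed

lemma KL_div_gibbs_product:
  fixes \<pi> :: "'a :: finite pmf"
  assumes pos: "\<forall>x. pmf \<pi> x > 0" and P: "P \<in> reversible_matrices \<pi>"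
    and S: "S \<noteq> {}" "S \<noteq> UNIV"
  shows "KL_div \<pi> (P ** gibbs_kernel \<pi> S) (stationary_matrix \<pi>) = T_fun \<pi> P S - U_fun \<pi> S"
proof -
  have tm: "transition_matrix P" using P by (simp add: reversible_matrices_def)
  \<comment> \<open>The contribution of block \<open>A\<close> to the relative entropy of row
    \<open>x\<close> of the product with respect to \<open>\<pi>\<close>.\<close>
  define K where
    "K A x = trans_prob P x A * ln (trans_prob P x A / measure_pmf.prob \<pi> A)" for A x
  have block: "(\<Sum>y\<in>A. (P ** gibbs_kernel \<pi> S) $ x $ y
      * ln ((P ** gibbs_kernel \<pi> S) $ x $ y / pmf \<pi> y)) = K A x"
    if A: "A = S \<or> A = - S" for A x
  proof -
    have "0 < measure_pmf.prob \<pi> A" using A S by (intro prob_pos[OF pos]) auto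
    let ?r = "trans_prob P x A / measure_pmf.prob \<pi> A"
    \<comment> \<open>Dividing by the mass of \<open>y\<close> leaves the density \<open>?r\<close>,
      constant on \<open>A\<close>, so the sum over \<open>A\<close> only collects the mass of
      \<open>A\<close>.\<close>
    have "pmf \<pi> y \<noteq> 0" for y using pos[rule_format, of y] by simp
    then have "(\<Sum>y\<in>A. (P ** gibbs_kernel \<pi> S) $ x $ y
        * ln ((P ** gibbs_kernel \<pi> S) $ x $ y / pmf \<pi> y)) = (\<Sum>y\<in>A. pmf \<pi> y * (?r * ln ?r))"
      using A by (intro sum.cong) (auto simp: gibbs_product_component)
    also have "\<dots> = measure_pmf.prob \<pi> A * (?r * ln ?r)"
      by (simp only: prob_eq_sum_pmf sum_distrib_right)
    also have "\<dots> = K A x"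
      using \<open>0 < measure_pmf.prob \<pi> A\<close> by (simp add: K_def)
    finally show ?thesis .
  qed
  \<comment> \<open>Splitting the logarithm leaves a term with the constant factor
    \<open>ln (measure_pmf.prob \<pi> A)\<close>; stationarity averages it to \<open>xlogx\<close>
    of the mass of \<open>A\<close>.\<close>
  have inner: "(\<Sum>x\<in>UNIV. pmf \<pi> x * K A x)
      = (\<Sum>x\<in>UNIV. pmf \<pi> x * xlogx (trans_prob P x A)) - xlogx (measure_pmf.prob \<pi> A)"
    if "A \<noteq> {}" for A
  proof -
    have K: "K A x = xlogx (trans_prob P x A) - trans_prob P x A * ln (measure_pmf.prob \<pi> A)" for x
      using prob_pos[OF pos that] trans_prob_nonneg[OF tm, of x A]
      by (cases "trans_prob P x A = 0") (simp_all add: K_def xlogx_def ln_div algebra_simps)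
    have "(\<Sum>x\<in>UNIV. pmf \<pi> x * (trans_prob P x A * ln (measure_pmf.prob \<pi> A)))
        = xlogx (measure_pmf.prob \<pi> A)"
      by (simp add: xlogx_def reversible_sum_trans_prob[OF P] flip: mult.assoc sum_distrib_right)
    then show ?thesis by (simp add: K right_diff_distrib sum_subtractf)
  qed
  have split: "(\<Sum>y\<in>UNIV. g y) = (\<Sum>y\<in>S. g y) + (\<Sum>y\<in>- S. g y)" for g :: "'a \<Rightarrow> real"
    using sum.union_disjoint[of S "- S" g] by simp
  have "KL_div \<pi> (P ** gibbs_kernel \<pi> S) (stationary_matrix \<pi>)
      = (\<Sum>x\<in>UNIV. pmf \<pi> x * (\<Sum>y\<in>UNIV. (P ** gibbs_kernel \<pi> S) $ x $ y
          * ln ((P ** gibbs_kernel \<pi> S) $ x $ y / pmf \<pi> y)))"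
    by (simp add: KL_div_def stationary_matrix_def sum_distrib_left mult.assoc)
  also have "\<dots> = (\<Sum>x\<in>UNIV. pmf \<pi> x * (K S x + K (- S) x))"
    by (subst split) (simp add: block)
  also have "\<dots> = (\<Sum>x\<in>UNIV. pmf \<pi> x * K S x) + (\<Sum>x\<in>UNIV. pmf \<pi> x * K (- S) x)"
    by (simp add: distrib_left sum.distrib)
  also have "\<dots> = T_fun \<pi> P S - U_fun \<pi> S"
    \<comment> \<open>Since \<open>S\<close> is neither empty nor everything, \<open>inner\<close>
      applies to both blocks.\<close>
    using S by (subst (1 2) inner) (auto simp: T_fun_def U_fun_def distrib_left sum.distrib)
  finally show ?thesis .
qed

lemma entropy_rate_gibbs_product:
  fixes \<pi> :: "'a :: finite pmf"
  assumes "\<forall>x. pmf \<pi> x > 0" "P \<in> reversible_matrices \<pi>"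
  shows "entropy_rate \<pi> (P ** gibbs_kernel \<pi> S)
    = shannon_entropy \<pi> - KL_div \<pi> (P ** gibbs_kernel \<pi> S) (stationary_matrix \<pi>)"
proof (rule entropy_rate_eq_KL_div_stationary[OF assms(1)])
  have "transition_matrix P" using assms(2) by (simp add: reversible_matrices_def)
  then show "0 \<le> (P ** gibbs_kernel \<pi> S) $ x $ y" for x y
    by (simp add: gibbs_product_component trans_prob_nonneg)
qed (rule gibbs_product_stationary[OF assms])

theorem proposition6p3:
  fixes \<pi> :: "'a :: finite pmf" and P :: "real ^ 'a ^ 'a"
  assumes "\<forall>x. pmf \<pi> x > 0"
    and "P \<in> reversible_matrices \<pi>"
  shows "(\<forall>S. S \<noteq> {} \<and> S \<noteq> UNIV \<longrightarrow>
            entropy_rate \<pi> (P ** gibbs_kernel \<pi> S)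
              = shannon_entropy \<pi> - KL_div \<pi> (P ** gibbs_kernel \<pi> S) (stationary_matrix \<pi>) \<and>
            shannon_entropy \<pi> - KL_div \<pi> (P ** gibbs_kernel \<pi> S) (stationary_matrix \<pi>)
              = shannon_entropy \<pi> + U_fun \<pi> S - T_fun \<pi> P S \<and>
            entropy_rate \<pi> (P ** gibbs_kernel \<pi> S)
              = (- T_fun \<pi> P S) - (- (shannon_entropy \<pi> + U_fun \<pi> S)))
       \<and> supermodular (U_fun \<pi>)
       \<and> supermodular (\<lambda>S. shannon_entropy \<pi> + U_fun \<pi> S)
       \<and> supermodular (T_fun \<pi> P)
       \<and> submodular (\<lambda>S. - T_fun \<pi> P S)
       \<and> submodular (\<lambda>S. - (shannon_entropy \<pi> + U_fun \<pi> S))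
       \<and> {S. is_arg_min (\<lambda>S. KL_div \<pi> (P ** gibbs_kernel \<pi> S) (stationary_matrix \<pi>))
                (\<lambda>S. S \<noteq> {} \<and> S \<noteq> UNIV) S}
         = {S. is_arg_max (\<lambda>S. entropy_rate \<pi> (P ** gibbs_kernel \<pi> S))
                (\<lambda>S. S \<noteq> {} \<and> S \<noteq> UNIV) S}"
proof -
  \<comment> \<open>The entropy rate is a constant minus the divergence, so every strict comparison
    is reversed; this also identifies the arg max with the arg min.\<close>
  have H: "entropy_rate \<pi> (P ** gibbs_kernel \<pi> S)
      = shannon_entropy \<pi> - KL_div \<pi> (P ** gibbs_kernel \<pi> S) (stationary_matrix \<pi>)" for S
    by (rule entropy_rate_gibbs_product[OF assms])
  have U: "supermodular (U_fun \<pi>)" by (rule supermodular_U_fun)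
  then have HU: "supermodular (\<lambda>S. shannon_entropy \<pi> + U_fun \<pi> S)"
    by (intro supermodular_add supermodular_const)
  have T: "supermodular (T_fun \<pi> P)"
    using assms(2) by (intro supermodular_T_fun) (simp add: reversible_matrices_def)
  show ?thesis
    using U HU T
    by (auto simp: H KL_div_gibbs_product[OF assms] supermodular_def is_arg_min_def is_arg_max_def)
qed

end
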